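(* Let $X$ be a set with at least two elements. For every cross-connection $\Gamma$ from $\Pi(X)$ to $\mathscr P(X)$, the cross-connection semigroup $\tilde S\Gamma$ is isomorphic to $Sing(X)$.
   Context: All maps and morphisms are composed from left to right. $Sing(X)$ is the set of all non-invertible transformations of $X$, taken to be a (regular) subsemigroup, under composition, of the full transformation semigroup $\mathscr T_X$. $\pi_a$ is the kernel partition (non-empty fibres) of a transformation $a$. Powerset category $\mathscr P(X)$: objects are the non-empty proper subsets of $X$; morphisms $A\to B$ are all functions; inclusions are set inclusions. Category of partitions $\Pi(X)$: a partition is non-identity if at least one block has more than one element. For such $\pi$, $\bar\pi$ is the set of all functions from (the set of blocks) $\pi$ to $X$. Objects are the $\bar\pi$; morphisms $\bar\pi_1\to\bar\pi_2$ are the maps $\eta^\ast:\alpha\mapsto\eta\alpha$ for functions $\eta:\pi_2\to\pi_1$. Write $\bar\pi_1\subseteq\bar\pi_2$ if every block of $\pi_2$ lies in a block of $\pi_1$; the inclusion is then $\nu^\ast$, with $\nu:\pi_2\to\pi_1$ sending each block to the block containing it. A local isomorphism is an inclusion-preserving, fully faithful functor $F$ which for each object $c$ restricts to an isomorphism of $\langle c\rangle$ onto $\langle F(c)\rangle$, where $\langle c\rangle$ is the full subcategory on the subobjects of $c$. A cross-section of a partition is a set containing exactly one element of each block. With the normal duals $N^\ast\mathscr P(X)$ and $N^\ast\Pi(X)$ identified with $\Pi(X)$ and $\mathscr P(X)$ respectively: a cross-connection from $\Pi(X)$ to $\mathscr P(X)$ is a local isomorphism $\Gamma:\Pi(X)\to\Pi(X)$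 such that every object $A$ of $\mathscr P(X)$ is a cross-section of some $\Gamma(\bar\pi)$; a cross-connection from $\mathscr P(X)$ to $\Pi(X)$ is a local isomorphism $\Delta:\mathscr P(X)\to\mathscr P(X)$ such that for every $\bar\pi$ there is $A$ with $\Delta(A)$ a cross-section of $\pi$. Bifunctors: $\Gamma(A,\bar\pi)=\{a\in Sing(X):\mathrm{Im}\,a\subseteq A,\ \bar\pi_a\subseteq\Gamma(\bar\pi)\}$ and $\Delta(A,\bar\pi)=\{a\in Sing(X):\mathrm{Im}\,a\subseteq\Delta(A),\ \bar\pi_a\subseteq\bar\pi\}$; for $(f,v^\ast):(A,\bar\pi)\to(B,\bar\pi')$, $\Gamma(f,v^\ast):a\mapsto uaf$ with $u^\ast=\Gamma(v^\ast)$, and $\Delta(f,v^\ast):a\mapsto vag$ with $g=\Delta(f)$ (a transformation constant on the blocks of a partition is regarded as a map from that partition to $X$, and conversely). The dual cross-connection of $\Gamma$ is the unique cross-connection $\Delta$ from $\mathscr P(X)$ to $\Pi(X)$ such that, for all $A,\bar\pi$, $A$ is a cross-section of $\Gamma(\bar\pi)$ iff $\Delta(A)$ is a cross-section of $\pi$, and such that there is a natural isomorphism $\chi_\Gamma:\Gamma(-,-)\to\Delta(-,-)$, called the duality. Put $U\Gamma=\bigcup_{A,\bar\pi}\Gamma(A,\bar\pi)$ (composition of transformations) and $U\Delta=\bigcup_{A,\bar\pi}\Delta(A,\bar\pi)$ (opposite multiplication $b'\ast b=bb'$). An element $a\in U\Gamma$ is linked to $b\in U\Delta$ if for some $(A,\bar\pi)$,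 $a\in\Gamma(A,\bar\pi)$ and $b=\chi_\Gamma(A,\bar\pi)(a)$. The cross-connection semigroup is $\tilde S\Gamma=\{(a,b)\in U\Gamma\times U\Delta: a\text{ is linked to }b\}$ with $(a,b)\circ(a',b')=(aa',\,b'\ast b)$.
   Formalization: The formal theorem assumes that Sing(X) is closed under composition, which forces X to be finite (for infinite X, Sing(X) is not a semigroup); it applies to each Γ with a dual cross-connection and duality as described, and takes the closure of S̃Γ under its product as background. *)

theory Defs
  imports "HOL-Algebra.Group" "HOL-Library.Disjoint_Sets"
begin

section \<open>Categories with subobjects, functors, local isomorphisms\<close>

text \<open>
  Morphisms are indexed by their source and target, so one and the same HOL function may
  represent morphisms with different targets.  Composition is diagrammatic:
  \<open>Cmp C c d e f g\<close> is "first \<open>f : c \<rightarrow> d\<close>, then \<open>g : d \<rightarrow> e\<close>".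
\<close>

record ('o, 'm) subobj_category =
  Ob :: "'o set"
  Mor :: "'o \<Rightarrow> 'o \<Rightarrow> 'm set"
  Idn :: "'o \<Rightarrow> 'm"
  Cmp :: "'o \<Rightarrow> 'o \<Rightarrow> 'o \<Rightarrow> 'm \<Rightarrow> 'm \<Rightarrow> 'm"
  Sub :: "'o \<Rightarrow> 'o \<Rightarrow> bool"
  Incl :: "'o \<Rightarrow> 'o \<Rightarrow> 'm"

record ('o1, 'm1, 'o2, 'm2) cat_functor =
  omap :: "'o1 \<Rightarrow> 'o2"
  mmap :: "'o1 \<Rightarrow> 'o1 \<Rightarrow> 'm1 \<Rightarrow> 'm2"

definition is_functor ::
  "('o1, 'm1) subobj_category \<Rightarrow> ('o2, 'm2) subobj_category \<Rightarrow> ('o1, 'm1, 'o2, 'm2) cat_functor \<Rightarrow> bool"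
where
  "is_functor C D F \<longleftrightarrow>
     (\<forall>c\<in>Ob C. omap F c \<in> Ob D) \<and>
     (\<forall>c\<in>Ob C. \<forall>d\<in>Ob C. \<forall>f\<in>Mor C c d. mmap F c d f \<in> Mor D (omap F c) (omap F d)) \<and>
     (\<forall>c\<in>Ob C. mmap F c c (Idn C c) = Idn D (omap F c)) \<and>
     (\<forall>c\<in>Ob C. \<forall>d\<in>Ob C. \<forall>e\<in>Ob C. \<forall>f\<in>Mor C c d. \<forall>g\<in>Mor C d e.
        mmap F c e (Cmp C c d e f g) =
        Cmp D (omap F c) (omap F d) (omap F e) (mmap F c d f) (mmap F d e g))"

definition fully_faithful ::
  "('o1, 'm1) subobj_category \<Rightarrow> ('o2, 'm2) subobj_category \<Rightarrow> ('o1, 'm1, 'o2, 'm2) cat_functor \<Rightarrow> bool"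
where
  "fully_faithful C D F \<longleftrightarrow>
     (\<forall>c\<in>Ob C. \<forall>d\<in>Ob C. bij_betw (mmap F c d) (Mor C c d) (Mor D (omap F c) (omap F d)))"

definition inclusion_preserving ::
  "('o1, 'm1) subobj_category \<Rightarrow> ('o2, 'm2) subobj_category \<Rightarrow> ('o1, 'm1, 'o2, 'm2) cat_functor \<Rightarrow> bool"
where
  "inclusion_preserving C D F \<longleftrightarrow>
     (\<forall>c\<in>Ob C. \<forall>d\<in>Ob C. Sub C c d \<longrightarrow>
        Sub D (omap F c) (omap F d) \<and> mmap F c d (Incl C c d) = Incl D (omap F c) (omap F d))"

definition cat_isomorphism ::
  "('o1, 'm1) subobj_category \<Rightarrow> ('o2, 'm2) subobj_category \<Rightarrow> ('o1, 'm1, 'o2, 'm2) cat_functor \<Rightarrow> bool"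
where
  "cat_isomorphism C D F \<longleftrightarrow>
     is_functor C D F \<and> bij_betw (omap F) (Ob C) (Ob D) \<and> fully_faithful C D F"

text \<open>The full subcategory \<open>\<langle>c\<rangle>\<close> on the subobjects of \<open>c\<close>.\<close>

definition ideal_at :: "('o, 'm) subobj_category \<Rightarrow> 'o \<Rightarrow> ('o, 'm) subobj_category" where
  "ideal_at C c = C\<lparr>Ob := {d \<in> Ob C. Sub C d c}\<rparr>"

definition local_isomorphism ::
  "('o1, 'm1) subobj_category \<Rightarrow> ('o2, 'm2) subobj_category \<Rightarrow> ('o1, 'm1, 'o2, 'm2) cat_functor \<Rightarrow> bool"
where
  "local_isomorphism C D F \<longleftrightarrow>
     is_functor C D F \<and> inclusion_preserving C D F \<and> fully_faithful C D F \<and>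
     (\<forall>c\<in>Ob C. cat_isomorphism (ideal_at C c) (ideal_at D (omap F c)) F)"


section \<open>Singular transformations\<close>

text \<open>
  A transformation of the set \<open>X\<close> is an element of \<open>X \<rightarrow>\<^sub>E X\<close>.
  \<open>tmul X a b\<close> is the product \<open>ab\<close>, i.e. first \<open>a\<close>, then \<open>b\<close>
  (whereas \<open>compose X b a\<close> applies \<open>a\<close> first).
\<close>

definition Sing :: "'a set \<Rightarrow> ('a \<Rightarrow> 'a) set" where
  "Sing X = {a \<in> X \<rightarrow>\<^sub>E X. \<not> bij_betw a X X}"

definition tmul :: "'a set \<Rightarrow> ('a \<Rightarrow> 'a) \<Rightarrow> ('a \<Rightarrow> 'a) \<Rightarrow> ('a \<Rightarrow> 'a)" where
  "tmul X a b = compose X b a"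

definition kernel_partition :: "'a set \<Rightarrow> ('a \<Rightarrow> 'b) \<Rightarrow> 'a set set" where
  "kernel_partition X a = (\<lambda>x. {y \<in> X. a y = a x}) ` X"

text \<open>
  Semigroups are represented by the record of HOL-Algebra for monoids, of which only the carrier and
  the multiplication matter; the relation \<open>\<cong>\<close> does not refer to the remaining field \<open>one\<close>.
\<close>

definition Sing_semigroup :: "'a set \<Rightarrow> ('a \<Rightarrow> 'a) monoid" where
  "Sing_semigroup X = \<lparr>carrier = Sing X, mult = tmul X, one = undefined\<rparr>"


section \<open>The powerset category\<close>

definition powerset_cat :: "'a set \<Rightarrow> ('a set, 'a \<Rightarrow> 'a) subobj_category" where
  "powerset_cat X = \<lparr>
     Ob = {A. A \<subseteq> X \<and> A \<noteq> {} \<and> A \<noteq> X},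
     Mor = (\<lambda>A B. A \<rightarrow>\<^sub>E B),
     Idn = (\<lambda>A. \<lambda>x\<in>A. x),
     Cmp = (\<lambda>A B C f g. compose A g f),
     Sub = (\<lambda>A B. A \<subseteq> B),
     Incl = (\<lambda>A B. \<lambda>x\<in>A. x)\<rparr>"


section \<open>The category of partitions\<close>

definition nonid_partition :: "'a set \<Rightarrow> 'a set set \<Rightarrow> bool" where
  "nonid_partition X \<pi> \<longleftrightarrow> partition_on X \<pi> \<and> (\<exists>B\<in>\<pi>. \<exists>x\<in>B. \<exists>y\<in>B. x \<noteq> y)"

text \<open>\<open>bar X \<pi>\<close> is the object written \<open>\<pi>\<close> with a bar: all functions from the set of blocks to \<open>X\<close>.\<close>

definition bar :: "'a set \<Rightarrow> 'a set set \<Rightarrow> ('a set \<Rightarrow> 'a) set" where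
  "bar X \<pi> = \<pi> \<rightarrow>\<^sub>E X"

text \<open>The partition underlying an object; it is well defined by lemma \<open>blocks_bar\<close> below.\<close>

definition blocks :: "'a set \<Rightarrow> ('a set \<Rightarrow> 'a) set \<Rightarrow> 'a set set" where
  "blocks X c = (THE \<pi>. nonid_partition X \<pi> \<and> c = bar X \<pi>)"

text \<open>For \<open>\<eta> : \<pi>2 \<rightarrow> \<pi>1\<close>, the map \<open>\<eta>\<^sup>*\<close> from \<open>bar X \<pi>1\<close> to \<open>bar X \<pi>2\<close> sends
  \<open>\<alpha>\<close> to "first \<open>\<eta>\<close>, then \<open>\<alpha>\<close>".\<close>

definition star ::
  "'a set \<Rightarrow> 'a set set \<Rightarrow> 'a set set \<Rightarrow> ('a set \<Rightarrow> 'a set) \<Rightarrow> (('a set \<Rightarrow> 'a) \<Rightarrow> ('a set \<Rightarrow> 'a))"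
where
  "star X \<pi>1 \<pi>2 \<eta> = (\<lambda>\<alpha>\<in>bar X \<pi>1. compose \<pi>2 \<alpha> \<eta>)"

text \<open>The \<open>\<eta>\<close> with \<open>\<eta>\<^sup>* = m\<close>; see lemma \<open>unstar_star\<close> below.\<close>

definition unstar ::
  "'a set \<Rightarrow> 'a set set \<Rightarrow> 'a set set \<Rightarrow> (('a set \<Rightarrow> 'a) \<Rightarrow> ('a set \<Rightarrow> 'a)) \<Rightarrow> ('a set \<Rightarrow> 'a set)"
where
  "unstar X \<pi>1 \<pi>2 m = (THE \<eta>. \<eta> \<in> \<pi>2 \<rightarrow>\<^sub>E \<pi>1 \<and> star X \<pi>1 \<pi>2 \<eta> = m)"

definition containing_block :: "'a set set \<Rightarrow> 'a set set \<Rightarrow> ('a set \<Rightarrow> 'a set)" where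
  "containing_block \<pi>1 \<pi>2 = (\<lambda>B\<in>\<pi>2. THE C. C \<in> \<pi>1 \<and> B \<subseteq> C)"

definition partition_cat ::
  "'a set \<Rightarrow> (('a set \<Rightarrow> 'a) set, ('a set \<Rightarrow> 'a) \<Rightarrow> ('a set \<Rightarrow> 'a)) subobj_category"
where
  "partition_cat X = \<lparr>
     Ob = bar X ` {\<pi>. nonid_partition X \<pi>},
     Mor = (\<lambda>c d. star X (blocks X c) (blocks X d) ` (blocks X d \<rightarrow>\<^sub>E blocks X c)),
     Idn = (\<lambda>c. \<lambda>\<alpha>\<in>c. \<alpha>),
     Cmp = (\<lambda>c d e f g. compose c g f),
     Sub = (\<lambda>c d. \<exists>\<pi>1 \<pi>2. nonid_partition X \<pi>1 \<and> nonid_partition X \<pi>2 \<and>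
                    c = bar X \<pi>1 \<and> d = bar X \<pi>2 \<and> (\<forall>B\<in>\<pi>2. \<exists>C\<in>\<pi>1. B \<subseteq> C)),
     Incl = (\<lambda>c d. star X (blocks X c) (blocks X d) (containing_block (blocks X c) (blocks X d)))\<rparr>"

lemma nonid_partition_two: "nonid_partition X \<pi> \<Longrightarrow> \<exists>x\<in>X. \<exists>y\<in>X. x \<noteq> y"
  unfolding nonid_partition_def partition_on_def by blast

lemma bar_inject:
  assumes "x \<in> X" "y \<in> X" "x \<noteq> y" and eq: "bar X \<pi>1 = bar X \<pi>2"
  shows "\<pi>1 \<subseteq> \<pi>2"
proof
  fix B assume B: "B \<in> \<pi>1"
  show "B \<in> \<pi>2"
  proof (rule ccontr)
    assume nB: "B \<notin> \<pi>2"
    have "(\<lambda>C\<in>\<pi>1. x) \<in> bar X \<pi>2" "(\<lambda>C\<in>\<pi>1. y) \<in> bar X \<pi>2"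
      unfolding eq [symmetric] using assms by (auto simp: bar_def)
    then have "(\<lambda>C\<in>\<pi>1. x) B = undefined" "(\<lambda>C\<in>\<pi>1. y) B = undefined"
      using nB unfolding bar_def by (blast intro: PiE_arb)+
    then show False using B \<open>x \<noteq> y\<close> by simp
  qed
qed

lemma blocks_bar:
  assumes "nonid_partition X \<pi>" shows "blocks X (bar X \<pi>) = \<pi>"
proof -
  obtain x y where "x \<in> X" "y \<in> X" "x \<noteq> y" using nonid_partition_two [OF assms] by blast
  then show ?thesis
    unfolding blocks_def using assms by (auto intro!: the_equality dest: bar_inject)
qed

lemma unstar_star:
  assumes xy: "x \<in> X" "y \<in> X" "x \<noteq> y" and \<eta>: "\<eta> \<in> \<pi>2 \<rightarrow>\<^sub>E \<pi>1"
  shows "unstar X \<pi>1 \<pi>2 (star X \<pi>1 \<pi>2 \<eta>) = \<eta>"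
  unfolding unstar_def
proof (rule the_equality)
  fix \<theta> assume \<theta>: "\<theta> \<in> \<pi>2 \<rightarrow>\<^sub>E \<pi>1 \<and> star X \<pi>1 \<pi>2 \<theta> = star X \<pi>1 \<pi>2 \<eta>"
  show "\<theta> = \<eta>"
  proof (rule PiE_ext)
    show "\<theta> \<in> \<pi>2 \<rightarrow>\<^sub>E \<pi>1" "\<eta> \<in> \<pi>2 \<rightarrow>\<^sub>E \<pi>1" using \<theta> \<eta> by auto
    fix B assume B: "B \<in> \<pi>2"
    define \<alpha> where "\<alpha> = (\<lambda>C\<in>\<pi>1. if C = \<eta> B then x else y)"
    have "\<alpha> \<in> bar X \<pi>1" using xy by (auto simp: \<alpha>_def bar_def)
    then have "compose \<pi>2 \<alpha> \<theta> B = compose \<pi>2 \<alpha> \<eta> B"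
      using \<theta> by (metis star_def restrict_apply')
    moreover have "\<theta> B \<in> \<pi>1" "\<eta> B \<in> \<pi>1" using \<theta> \<eta> B by auto
    ultimately show "\<theta> B = \<eta> B" using B xy by (auto simp: compose_def \<alpha>_def split: if_splits)
  qed
qed (use \<eta> in auto)


section \<open>Cross-connections\<close>

definition cross_section :: "'a set \<Rightarrow> 'a set \<Rightarrow> 'a set set \<Rightarrow> bool" where
  "cross_section X A \<pi> \<longleftrightarrow> A \<subseteq> X \<and> (\<forall>B\<in>\<pi>. \<exists>!x. x \<in> A \<and> x \<in> B)"

type_synonym 'a partition_endofunctor =
  "(('a set \<Rightarrow> 'a) set, ('a set \<Rightarrow> 'a) \<Rightarrow> ('a set \<Rightarrow> 'a),
    ('a set \<Rightarrow> 'a) set, ('a set \<Rightarrow> 'a) \<Rightarrow> ('a set \<Rightarrow> 'a)) cat_functor"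

type_synonym 'a powerset_endofunctor = "('a set, 'a \<Rightarrow> 'a, 'a set, 'a \<Rightarrow> 'a) cat_functor"

text \<open>
  The normal dual of the powerset category is identified with the category of partitions and vice
  versa, so that both kinds of cross-connections are endofunctors.
\<close>

definition cross_connection_Pi_P :: "'a set \<Rightarrow> 'a partition_endofunctor \<Rightarrow> bool" where
  "cross_connection_Pi_P X \<Gamma> \<longleftrightarrow>
     local_isomorphism (partition_cat X) (partition_cat X) \<Gamma> \<and>
     (\<forall>A\<in>Ob (powerset_cat X). \<exists>c\<in>Ob (partition_cat X). cross_section X A (blocks X (omap \<Gamma> c)))"

definition cross_connection_P_Pi :: "'a set \<Rightarrow> 'a powerset_endofunctor \<Rightarrow> bool" where
  "cross_connection_P_Pi X \<Delta> \<longleftrightarrow>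
     local_isomorphism (powerset_cat X) (powerset_cat X) \<Delta> \<and>
     (\<forall>c\<in>Ob (partition_cat X). \<exists>A\<in>Ob (powerset_cat X). cross_section X (omap \<Delta> A) (blocks X c))"


section \<open>The bifunctors of a cross-connection and the duality\<close>

definition \<Gamma>_set :: "'a set \<Rightarrow> 'a partition_endofunctor \<Rightarrow> 'a set \<Rightarrow> ('a set \<Rightarrow> 'a) set \<Rightarrow> ('a \<Rightarrow> 'a) set"
where
  "\<Gamma>_set X \<Gamma> A c =
     {a \<in> Sing X. a ` X \<subseteq> A \<and> Sub (partition_cat X) (bar X (kernel_partition X a)) (omap \<Gamma> c)}"

definition \<Delta>_set :: "'a set \<Rightarrow> 'a powerset_endofunctor \<Rightarrow> 'a set \<Rightarrow> ('a set \<Rightarrow> 'a) set \<Rightarrow> ('a \<Rightarrow> 'a) set"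
where
  "\<Delta>_set X \<Delta> A c =
     {a \<in> Sing X. a ` X \<subseteq> omap \<Delta> A \<and> Sub (partition_cat X) (bar X (kernel_partition X a)) c}"

text \<open>
  Let \<open>w : \<pi>' \<rightarrow> \<pi>\<close> be a map of blocks, \<open>a\<close> a transformation constant on the blocks of \<open>\<pi>\<close>,
  and \<open>f\<close> a map on the image of \<open>a\<close>.  Regarding \<open>a\<close> as a map on \<open>\<pi>\<close>, the composite
  "first \<open>w\<close>, then \<open>a\<close>, then \<open>f\<close>" is a map on \<open>\<pi>'\<close>; \<open>waf X \<pi>' w a f\<close> is this composite, regarded
  as a transformation constant on the blocks of \<open>\<pi>'\<close>.
\<close>

definition block_of :: "'a set set \<Rightarrow> 'a \<Rightarrow> 'a set" where
  "block_of \<pi> x = (THE B. B \<in> \<pi> \<and> x \<in> B)"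

definition on_blocks :: "('a \<Rightarrow> 'a) \<Rightarrow> 'a set \<Rightarrow> 'a" where
  "on_blocks a B = the_elem (a ` B)"

definition waf ::
  "'a set \<Rightarrow> 'a set set \<Rightarrow> ('a set \<Rightarrow> 'a set) \<Rightarrow> ('a \<Rightarrow> 'a) \<Rightarrow> ('a \<Rightarrow> 'a) \<Rightarrow> ('a \<Rightarrow> 'a)"
where
  "waf X \<pi>' w a f = (\<lambda>x\<in>X. f (on_blocks a (w (block_of \<pi>' x))))"

text \<open>The action of the bifunctors on a morphism \<open>(f, m) : (A, c) \<rightarrow> (B, c')\<close>.\<close>

definition \<Gamma>_map ::
  "'a set \<Rightarrow> 'a partition_endofunctor \<Rightarrow> ('a set \<Rightarrow> 'a) set \<Rightarrow> ('a set \<Rightarrow> 'a) set \<Rightarrow>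
   ('a \<Rightarrow> 'a) \<Rightarrow> (('a set \<Rightarrow> 'a) \<Rightarrow> ('a set \<Rightarrow> 'a)) \<Rightarrow> ('a \<Rightarrow> 'a) \<Rightarrow> ('a \<Rightarrow> 'a)"
where
  "\<Gamma>_map X \<Gamma> c c' f m a =
     (let u = unstar X (blocks X (omap \<Gamma> c)) (blocks X (omap \<Gamma> c')) (mmap \<Gamma> c c' m)
      in waf X (blocks X (omap \<Gamma> c')) u a f)"

definition \<Delta>_map ::
  "'a set \<Rightarrow> 'a powerset_endofunctor \<Rightarrow> 'a set \<Rightarrow> 'a set \<Rightarrow> ('a set \<Rightarrow> 'a) set \<Rightarrow> ('a set \<Rightarrow> 'a) set \<Rightarrow>
   ('a \<Rightarrow> 'a) \<Rightarrow> (('a set \<Rightarrow> 'a) \<Rightarrow> ('a set \<Rightarrow> 'a)) \<Rightarrow> ('a \<Rightarrow> 'a) \<Rightarrow> ('a \<Rightarrow> 'a)"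
where
  "\<Delta>_map X \<Delta> A B c c' f m a =
     (let v = unstar X (blocks X c) (blocks X c') m;
          g = mmap \<Delta> A B f
      in waf X (blocks X c') v a g)"

type_synonym 'a bitransformation = "'a set \<Rightarrow> ('a set \<Rightarrow> 'a) set \<Rightarrow> ('a \<Rightarrow> 'a) \<Rightarrow> ('a \<Rightarrow> 'a)"

definition natural_bi_isomorphism ::
  "'a set \<Rightarrow> 'a partition_endofunctor \<Rightarrow> 'a powerset_endofunctor \<Rightarrow> 'a bitransformation \<Rightarrow> bool"
where
  "natural_bi_isomorphism X \<Gamma> \<Delta> \<chi> \<longleftrightarrow>
     (\<forall>A\<in>Ob (powerset_cat X). \<forall>c\<in>Ob (partition_cat X).
        bij_betw (\<chi> A c) (\<Gamma>_set X \<Gamma> A c) (\<Delta>_set X \<Delta> A c)) \<and>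
     (\<forall>A\<in>Ob (powerset_cat X). \<forall>B\<in>Ob (powerset_cat X).
      \<forall>c\<in>Ob (partition_cat X). \<forall>c'\<in>Ob (partition_cat X).
      \<forall>f\<in>Mor (powerset_cat X) A B. \<forall>m\<in>Mor (partition_cat X) c c'. \<forall>a\<in>\<Gamma>_set X \<Gamma> A c.
        \<chi> B c' (\<Gamma>_map X \<Gamma> c c' f m a) = \<Delta>_map X \<Delta> A B c c' f m (\<chi> A c a))"

text \<open>
  \<open>\<Delta>\<close> is a dual of \<open>\<Gamma>\<close>, with duality \<open>\<chi>\<close>.  Uniqueness of \<open>\<Delta>\<close> is not
  built in: it fails when \<open>X\<close> has exactly two elements, where any map between the two singletons
  gives a dual.
\<close>

definition dual_with_duality ::
  "'a set \<Rightarrow> 'a partition_endofunctor \<Rightarrow> 'a powerset_endofunctor \<Rightarrow> 'a bitransformation \<Rightarrow> bool"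
where
  "dual_with_duality X \<Gamma> \<Delta> \<chi> \<longleftrightarrow>
     cross_connection_P_Pi X \<Delta> \<and>
     (\<forall>A\<in>Ob (powerset_cat X). \<forall>c\<in>Ob (partition_cat X).
        cross_section X A (blocks X (omap \<Gamma> c)) \<longleftrightarrow> cross_section X (omap \<Delta> A) (blocks X c)) \<and>
     natural_bi_isomorphism X \<Gamma> \<Delta> \<chi>"


section \<open>The cross-connection semigroup\<close>

definition U\<Gamma> :: "'a set \<Rightarrow> 'a partition_endofunctor \<Rightarrow> ('a \<Rightarrow> 'a) set" where
  "U\<Gamma> X \<Gamma> = (\<Union>A\<in>Ob (powerset_cat X). \<Union>c\<in>Ob (partition_cat X). \<Gamma>_set X \<Gamma> A c)"

definition U\<Delta> :: "'a set \<Rightarrow> 'a powerset_endofunctor \<Rightarrow> ('a \<Rightarrow> 'a) set" where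
  "U\<Delta> X \<Delta> = (\<Union>A\<in>Ob (powerset_cat X). \<Union>c\<in>Ob (partition_cat X). \<Delta>_set X \<Delta> A c)"

definition op_tmul :: "'a set \<Rightarrow> ('a \<Rightarrow> 'a) \<Rightarrow> ('a \<Rightarrow> 'a) \<Rightarrow> ('a \<Rightarrow> 'a)" where
  "op_tmul X b' b = tmul X b b'"

definition linked ::
  "'a set \<Rightarrow> 'a partition_endofunctor \<Rightarrow> 'a bitransformation \<Rightarrow> ('a \<Rightarrow> 'a) \<Rightarrow> ('a \<Rightarrow> 'a) \<Rightarrow> bool"
where
  "linked X \<Gamma> \<chi> a b \<longleftrightarrow>
     (\<exists>A\<in>Ob (powerset_cat X). \<exists>c\<in>Ob (partition_cat X). a \<in> \<Gamma>_set X \<Gamma> A c \<and> b = \<chi> A c a)"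

definition cross_connection_semigroup ::
  "'a set \<Rightarrow> 'a partition_endofunctor \<Rightarrow> 'a powerset_endofunctor \<Rightarrow> 'a bitransformation \<Rightarrow>
   (('a \<Rightarrow> 'a) \<times> ('a \<Rightarrow> 'a)) monoid"
where
  "cross_connection_semigroup X \<Gamma> \<Delta> \<chi> = \<lparr>
     carrier = {(a, b). a \<in> U\<Gamma> X \<Gamma> \<and> b \<in> U\<Delta> X \<Delta> \<and> linked X \<Gamma> \<chi> a b},
     mult = (\<lambda>(a, b) (a', b'). (tmul X a a', op_tmul X b' b)),
     one = undefined\<rparr>"

end

theory Submission
  imports Defs
begin

text \<open>
  A non-surjective injection of an infinite set has a non-injective one-sided inverse, so the
  hypothesis that \<open>Sing X\<close> is closed under products forces \<open>X\<close> to be finite.  A partition is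
  determined by its cross-sections, and \<open>\<Delta>\<close> is surjective on objects as soon as \<open>X\<close> has three
  elements (with two elements there is only one non-identity partition); hence \<open>\<Gamma>\<close> is injective, and by finiteness bijective, on objects.  Every singular \<open>a\<close>
  therefore has a smallest pair \<open>(A, c)\<close> with \<open>a\<close> in \<open>\<Gamma>(A, c)\<close>, and naturality of \<open>\<chi>\<close> along
  inclusions shows that \<open>\<chi> A c a\<close> depends on \<open>a\<close> only.  So the first projection of the
  cross-connection semigroup is an isomorphism onto \<open>Sing X\<close>.
\<close>

section \<open>Objects and subobjects of the two categories\<close>

lemma powerset_cat_simps [simp]:
  "A \<in> Ob (powerset_cat X) \<longleftrightarrow> A \<subseteq> X \<and> A \<noteq> {} \<and> A \<noteq> X"
  "Sub (powerset_cat X) = (\<subseteq>)"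
  "Mor (powerset_cat X) A B = A \<rightarrow>\<^sub>E B"
  "Incl (powerset_cat X) A B = (\<lambda>x\<in>A. x)"
  by (auto simp: powerset_cat_def fun_eq_iff)

lemma Ob_partition_cat: "Ob (partition_cat X) = bar X ` {\<pi>. nonid_partition X \<pi>}"
  by (simp add: partition_cat_def)

lemma bar_inj: "nonid_partition X \<pi> \<Longrightarrow> nonid_partition X \<rho> \<Longrightarrow> bar X \<pi> = bar X \<rho> \<longleftrightarrow> \<pi> = \<rho>"
  by (metis blocks_bar)

lemma Sub_partition_cat_bar:
  assumes "nonid_partition X \<pi>" "nonid_partition X \<rho>"
  shows "Sub (partition_cat X) (bar X \<pi>) (bar X \<rho>) \<longleftrightarrow> (\<forall>B\<in>\<rho>. \<exists>C\<in>\<pi>. B \<subseteq> C)"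
  using assms by (auto simp: partition_cat_def bar_inj)

lemma nonid_partition_blocks:
  assumes "c \<in> Ob (partition_cat X)"
  shows "nonid_partition X (blocks X c)" "bar X (blocks X c) = c"
  using assms by (auto simp: Ob_partition_cat blocks_bar)

lemma Sub_partition_cat:
  assumes "c \<in> Ob (partition_cat X)" "d \<in> Ob (partition_cat X)"
  shows "Sub (partition_cat X) c d \<longleftrightarrow> (\<forall>B\<in>blocks X d. \<exists>C\<in>blocks X c. B \<subseteq> C)"
  using Sub_partition_cat_bar [of X "blocks X c" "blocks X d"] assms
  by (simp add: nonid_partition_blocks)

text \<open>The object part of the isomorphism of ideals, used to lift subobjects of
  \<open>omap F c\<close> to subobjects of \<open>c\<close>.\<close>

lemma local_isomorphism_ideal:
  assumes "local_isomorphism C D F" "c \<in> Ob C"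
  shows "bij_betw (omap F) {d \<in> Ob C. Sub C d c} {d \<in> Ob D. Sub D d (omap F c)}"
  using assms by (auto simp: local_isomorphism_def cat_isomorphism_def ideal_at_def)

lemma local_isomorphism_Ob:
  "local_isomorphism C D F \<Longrightarrow> c \<in> Ob C \<Longrightarrow> omap F c \<in> Ob D"
  by (auto simp: local_isomorphism_def is_functor_def)

lemma local_isomorphism_Incl:
  assumes "local_isomorphism C D F" "c \<in> Ob C" "d \<in> Ob C" "Sub C c d"
  shows "Sub D (omap F c) (omap F d)" "mmap F c d (Incl C c d) = Incl D (omap F c) (omap F d)"
  using assms by (auto simp: local_isomorphism_def inclusion_preserving_def)

section \<open>Closure under products and finiteness\<close>

lemma finite_if_Sing_closed:
  assumes closed: "\<forall>a\<in>Sing X. \<forall>b\<in>Sing X. tmul X a b \<in> Sing X"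
  shows "finite X"
proof (rule ccontr)
  assume inf: "infinite X"
  then obtain x where x: "x \<in> X" by fastforce
  obtain h where h: "bij_betw h X (X - {x})" using infinite_imp_bij_betw [OF inf] by blast
  define a where "a = (\<lambda>z\<in>X. h z)"
  \<comment> \<open>\<open>b\<close> undoes \<open>a\<close> on its image. Its value at the missed
    point \<open>x\<close> is \<open>x\<close>, which is also its value at \<open>h x\<close>, so
    \<open>b\<close> is not injective although \<open>tmul X a b\<close> is the identity.\<close>
  define b where "b = (\<lambda>z\<in>X. if z = x then x else inv_into X h z)"
  have hX: "h z \<in> X" "h z \<noteq> x" if "z \<in> X" for z using h that by (auto simp: bij_betw_def)
  have inv: "inv_into X h (h z) = z" if "z \<in> X" for z
    using h that by (auto simp: bij_betw_def)
  have bh: "b (h z) = z" if "z \<in> X" for z using that hX inv by (simp add: b_def)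
  have "x \<notin> a ` X" using hX by (auto simp: a_def)
  then have "a \<in> Sing X" using hX x by (auto simp: Sing_def a_def bij_betw_def)
  moreover have "b \<in> Sing X"
  proof -
    have "inv_into X h z \<in> X" if "z \<in> X" "z \<noteq> x" for z
      using h that by (metis DiffI bij_betw_imp_surj_on inv_into_into singletonD)
    moreover have "b x = b (h x)" "h x \<noteq> x" "h x \<in> X"
      using bh x hX by (auto simp: b_def)
    then have "\<not> inj_on b X" using x by (metis inj_onD)
    ultimately show ?thesis using x by (auto simp: Sing_def b_def bij_betw_def)
  qed
  ultimately have "tmul X a b \<in> Sing X" using closed by blast
  moreover have "tmul X a b = (\<lambda>z\<in>X. z)"
    using bh by (auto simp: tmul_def compose_def a_def fun_eq_iff)
  ultimately show False by (auto simp: Sing_def bij_betw_def inj_on_def)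
qed

section \<open>Partitions and their cross-sections\<close>

text \<open>A block with two distinct points already exhausts the set; for \<open>x = y\<close> the
  assumption is contradictory. This settles the case in which \<Delta> may fail to be injective on
  objects.\<close>

lemma nonid_partition_two_points:
  assumes "nonid_partition {x, y} \<pi>"
  shows "\<pi> = {{x, y}}"
proof -
  obtain B u v where B: "B \<in> \<pi>" "u \<in> B" "v \<in> B" "u \<noteq> v"
    using assms by (auto simp: nonid_partition_def)
  have p: "partition_on {x, y} \<pi>" using assms by (simp add: nonid_partition_def)
  then have sub: "C \<subseteq> {x, y}" "C \<noteq> {}" if "C \<in> \<pi>" for C
    using that by (auto simp: partition_on_def)
  have B2: "B = {x, y}" using sub [OF B(1)] B by blast
  have "C = B" if "C \<in> \<pi>" for C
    using p sub [OF that] B B2 that by (fastforce simp: partition_on_def disjoint_def)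
  then show ?thesis using B B2 by blast
qed

text \<open>Choose a representative in every block, prescribing \<open>x\<close> for
  \<open>B\<close> and \<open>y\<close> for \<open>C\<close>; the prescriptions do not clash because
  the blocks differ.\<close>

lemma cross_section_through:
  assumes "partition_on X \<pi>" "B \<in> \<pi>" "C \<in> \<pi>" "B \<noteq> C" "x \<in> B" "y \<in> C"
  obtains A where "cross_section X A \<pi>" "x \<in> A" "y \<in> A"
proof -
  define s where "s D = (if D = B then x else if D = C then y else (SOME z. z \<in> D))" for D
  have s: "s D \<in> D" if "D \<in> \<pi>" for D
    using assms that by (auto simp: s_def partition_on_def some_in_eq)
  have "cross_section X (s ` \<pi>) \<pi>"
    unfolding cross_section_def
  proof (intro conjI ballI)
    show "s ` \<pi> \<subseteq> X" using s assms(1) by (auto simp: partition_on_def)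
    fix D assume D: "D \<in> \<pi>"
    show "\<exists>!z. z \<in> s ` \<pi> \<and> z \<in> D"
    proof (rule ex1I [of _ "s D"])
      fix z assume "z \<in> s ` \<pi> \<and> z \<in> D"
      then obtain E where "E \<in> \<pi>" "z = s E" "s E \<in> D" by auto
      then have "E \<inter> D \<noteq> {}" using s by blast
      then have "E = D"
        using \<open>E \<in> \<pi>\<close> D assms(1) by (meson disjointD partition_onD2)
      then show "z = s D" using \<open>z = s E\<close> by simp
    qed (use s D in auto)
  qed
  moreover have "s B = x" "s C = y" using assms(4) by (auto simp: s_def)
  ultimately show thesis using that assms(2,3) by (metis image_eqI)
qed

text \<open>A block with two points is met exactly once, so the cross-section is non-empty and
  misses a point.\<close>

lemma cross_section_Ob:
  assumes "nonid_partition X \<pi>" "cross_section X A \<pi>"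
  shows "A \<in> Ob (powerset_cat X)"
proof -
  obtain B x y where B: "B \<in> \<pi>" "x \<in> B" "y \<in> B" "x \<noteq> y"
    using assms by (auto simp: nonid_partition_def)
  have "B \<subseteq> X" using assms B by (auto simp: nonid_partition_def partition_on_def)
  moreover have "\<exists>!z. z \<in> A \<and> z \<in> B" "A \<subseteq> X" using assms B by (auto simp: cross_section_def)
  ultimately have "A \<subseteq> X" "A \<noteq> {}" "\<not> (x \<in> A \<and> y \<in> A)" "x \<in> X" "y \<in> X" using B by blast+
  then show ?thesis by auto
qed

text \<open>Two distinct points lie in different blocks exactly when some cross-section contains
  both, so the cross-sections recover the blocks.\<close>

lemma partition_subset_if_cross_sections:
  assumes \<pi>: "partition_on X \<pi>" and \<rho>: "partition_on X \<rho>"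
    and le: "\<And>A. cross_section X A \<pi> \<Longrightarrow> cross_section X A \<rho>"
    and ge: "\<And>A. cross_section X A \<rho> \<Longrightarrow> cross_section X A \<pi>"
  shows "\<pi> \<subseteq> \<rho>"
proof
  \<comment> \<open>A point of \<open>B\<close> outside \<open>C\<close> would lie with
    \<open>x\<close> in a cross-section of \<tau>, hence of \<sigma>, which would then meet
    \<open>B\<close> twice.\<close>
  have sub: "B \<subseteq> C"
    if \<sigma>: "partition_on X \<sigma>" and \<tau>: "partition_on X \<tau>"
      and cs: "\<And>A. cross_section X A \<tau> \<Longrightarrow> cross_section X A \<sigma>"
      and B: "B \<in> \<sigma>" "x \<in> B" and C: "C \<in> \<tau>" "x \<in> C" for \<sigma> \<tau> B C x
  proof
    fix y assume y: "y \<in> B"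
    then obtain D where D: "D \<in> \<tau>" "y \<in> D"
      using \<sigma> \<tau> B unfolding partition_on_def by blast
    show "y \<in> C"
    proof (rule ccontr)
      assume "y \<notin> C"
      then have "C \<noteq> D" using D by blast
      then obtain A where A: "cross_section X A \<tau>" "x \<in> A" "y \<in> A"
        by (rule cross_section_through [OF \<tau> C(1) D(1) _ C(2) D(2)])
      then have "\<exists>!z. z \<in> A \<and> z \<in> B" using cs B by (auto simp: cross_section_def)
      then have "x = y" using A y B by blast
      then show False using \<open>y \<notin> C\<close> C by blast
    qed
  qed
  fix B assume B: "B \<in> \<pi>"
  then have "B \<noteq> {}" "B \<subseteq> X" using \<pi> by (auto simp: partition_on_def)
  then obtain x where x: "x \<in> B" "x \<in> X" by blast
  then obtain C where C: "C \<in> \<rho>" "x \<in> C" using \<rho> unfolding partition_on_def by blast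
  have "B = C" using sub [OF \<pi> \<rho> ge B x(1) C] sub [OF \<rho> \<pi> le C B x(1)] by blast
  then show "B \<in> \<rho>" using C by simp
qed

section \<open>Injectivity of \<Delta> and \<Gamma> on objects\<close>

text \<open>Isomorphisms of ideals give injectivity only below a common object; singletons carry it
  over to all objects. By \<open>big\<close>, read also for \<open>x = y\<close>, the union of two
  singletons of points of \<open>X\<close> is a proper subset, so any two singletons have a common
  upper bound.\<close>

lemma local_isomorphism_powerset_inj:
  assumes F: "local_isomorphism (powerset_cat X) (powerset_cat X) F"
    and big: "\<And>x y. X \<noteq> {x, y}"
  shows "inj_on (omap F) (Ob (powerset_cat X))"
proof -
  let ?P = "powerset_cat X"
  have ideal: "bij_betw (omap F) {D \<in> Ob ?P. D \<subseteq> A} {D \<in> Ob ?P. D \<subseteq> omap F A}"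
    if "A \<in> Ob ?P" for A
    using local_isomorphism_ideal [OF F that] by simp
  have mono: "omap F A \<subseteq> omap F B" if "A \<in> Ob ?P" "B \<in> Ob ?P" "A \<subseteq> B" for A B
    using local_isomorphism_Incl(1) [OF F that(1,2)] that(3) by simp
  have lift: "\<exists>E \<in> Ob ?P. E \<subseteq> B \<and> omap F E = D"
    if "B \<in> Ob ?P" "D \<in> Ob ?P" "D \<subseteq> omap F B" for B D
    using bij_betw_imp_surj_on [OF ideal [OF that(1)]] that
    by (smt (verit, best) imageE mem_Collect_eq)
  have sub: "A \<subseteq> B" if A: "A \<in> Ob ?P" and B: "B \<in> Ob ?P" and eq: "omap F A = omap F B" for A B
  proof
    fix x assume x: "x \<in> A"
    have pt: "{z} \<in> Ob ?P" if "z \<in> X" for z using that big [of z z] by auto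
    have xX: "x \<in> X" using x A by auto
    have "omap F {x} \<subseteq> omap F B" using mono [OF pt [OF xX] A] x eq by auto
    \<comment> \<open>The image of \<open>{x}\<close> is pulled back to a subset of
      \<open>B\<close>; a point \<open>z\<close> of it will turn out to be \<open>x\<close>.\<close>
    then obtain E where E: "E \<in> Ob ?P" "E \<subseteq> B" "omap F E = omap F {x}"
      using lift [OF B local_isomorphism_Ob [OF F pt [OF xX]]] by blast
    then obtain z where z: "z \<in> E" "z \<in> X" by auto
    have "omap F {z} \<subseteq> omap F {x}" using mono [OF pt [OF z(2)] E(1)] z E(3) by auto
    \<comment> \<open>Being a non-empty subset of \<open>{x}\<close>, \<open>W\<close> equals
      \<open>{x}\<close>, so \<open>{x}\<close> and \<open>{z}\<close> have the same image.\<close>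
    then obtain W where W: "W \<in> Ob ?P" "W \<subseteq> {x}" "omap F W = omap F {z}"
      using lift [OF pt [OF xX] local_isomorphism_Ob [OF F pt [OF z(2)]]] by blast
    then have "omap F {x} = omap F {z}" by (auto dest: subset_singletonD)
    moreover have "{x, z} \<in> Ob ?P" using xX z big [of x z] by auto
    ultimately have "{x} = {z}"
      using bij_betw_imp_inj_on [OF ideal [of "{x, z}"]] pt xX z
      by (auto dest!: inj_onD [where x = "{x}" and y = "{z}"])
    then show "x \<in> B" using z E by auto
  qed
  show ?thesis using sub by (intro inj_onI subset_antisym) auto
qed

lemma dual_inj_on_objects:
  assumes fin: "finite X"
    and \<Delta>: "local_isomorphism (powerset_cat X) (powerset_cat X) \<Delta>"
    and cs: "\<And>A c. A \<in> Ob (powerset_cat X) \<Longrightarrow> c \<in> Ob (partition_cat X) \<Longrightarrow>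
        cross_section X A (blocks X (omap \<Gamma> c)) \<longleftrightarrow> cross_section X (omap \<Delta> A) (blocks X c)"
  shows "inj_on (omap \<Gamma>) (Ob (partition_cat X))"
proof (rule inj_onI)
  fix c d assume c: "c \<in> Ob (partition_cat X)" and d: "d \<in> Ob (partition_cat X)"
    and eq: "omap \<Gamma> c = omap \<Gamma> d"
  note nc = nonid_partition_blocks [OF c] and nd = nonid_partition_blocks [OF d]
  have "blocks X c = blocks X d"
  proof (cases "\<exists>x y. X = {x, y}")
    case True
    then show ?thesis using nc nd nonid_partition_two_points by metis
  next
    case False
    have "inj_on (omap \<Delta>) (Ob (powerset_cat X))"
      using False by (intro local_isomorphism_powerset_inj [OF \<Delta>]) auto
    moreover have "finite (Ob (powerset_cat X))"
      by (rule finite_subset [of _ "Pow X"]) (use fin in auto)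
    moreover have "omap \<Delta> ` Ob (powerset_cat X) \<subseteq> Ob (powerset_cat X)"
      using local_isomorphism_Ob [OF \<Delta>] by blast
    ultimately have surj: "omap \<Delta> ` Ob (powerset_cat X) = Ob (powerset_cat X)"
      by (meson endo_inj_surj)
    \<comment> \<open>Write \<open>D\<close> as \<open>omap \<Delta> A\<close>: duality then asks
      whether \<open>A\<close> is a cross-section for \<open>omap \<Gamma> c\<close>, which is also
      \<open>omap \<Gamma> d\<close>.\<close>
    have same: "cross_section X D (blocks X c) \<longleftrightarrow> cross_section X D (blocks X d)"
      if D: "D \<in> Ob (powerset_cat X)" for D
    proof -
      obtain A where "A \<in> Ob (powerset_cat X)" "D = omap \<Delta> A"
        using D by (metis surj imageE)
      then show ?thesis using cs [OF _ c] cs [OF _ d] eq by metis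
    qed
    have "cross_section X D (blocks X c) \<longleftrightarrow> cross_section X D (blocks X d)" for D
      using same cross_section_Ob nc(1) nd(1) by blast
    then show ?thesis
      using nc(1) nd(1) unfolding nonid_partition_def
      by (intro subset_antisym partition_subset_if_cross_sections) auto
  qed
  then show "c = d" using nc nd by metis
qed

section \<open>The bifunctors along inclusions\<close>

lemma block_of:
  assumes "partition_on X \<pi>" "x \<in> X"
  shows "block_of \<pi> x \<in> \<pi>" "x \<in> block_of \<pi> x"
proof -
  have "\<exists>!B. B \<in> \<pi> \<and> x \<in> B" using assms by (auto simp: partition_on_def disjoint_def)
  from theI' [OF this] show "block_of \<pi> x \<in> \<pi>" "x \<in> block_of \<pi> x"
    by (auto simp: block_of_def)
qed

lemma containing_block:
  assumes "partition_on X \<pi>" "partition_on X \<rho>" "\<forall>B\<in>\<rho>. \<exists>C\<in>\<pi>. B \<subseteq> C" "B \<in> \<rho>"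
  shows "containing_block \<pi> \<rho> B \<in> \<pi>" "B \<subseteq> containing_block \<pi> \<rho> B"
proof -
  have "B \<noteq> {}" using assms by (auto simp: partition_on_def)
  moreover obtain C where C: "C \<in> \<pi>" "B \<subseteq> C" using assms(3,4) by blast
  moreover have "D = C" if "D \<in> \<pi>" "B \<subseteq> D" for D
    using that C \<open>B \<noteq> {}\<close> disjointD [OF partition_onD2 [OF assms(1)], of D C] by blast
  ultimately have "\<exists>!C. C \<in> \<pi> \<and> B \<subseteq> C" by blast
  from theI' [OF this] show "containing_block \<pi> \<rho> B \<in> \<pi>" "B \<subseteq> containing_block \<pi> \<rho> B"
    using assms by (auto simp: containing_block_def)
qed

text \<open>Decodes an inclusion of partition objects into the block map that the bifunctors use,
  and makes it available as a morphism for naturality. Two distinct points of \<open>X\<close> are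
  what makes the decoding unique.\<close>

lemma unstar_Incl:
  assumes c: "c \<in> Ob (partition_cat X)" and d: "d \<in> Ob (partition_cat X)"
    and sub: "Sub (partition_cat X) c d"
  shows "unstar X (blocks X c) (blocks X d) (Incl (partition_cat X) c d) =
      containing_block (blocks X c) (blocks X d)"
    and "Incl (partition_cat X) c d \<in> Mor (partition_cat X) c d"
proof -
  have p: "partition_on X (blocks X c)" "partition_on X (blocks X d)"
    using nonid_partition_blocks c d by (auto simp: nonid_partition_def)
  have le: "\<forall>B\<in>blocks X d. \<exists>C\<in>blocks X c. B \<subseteq> C" using Sub_partition_cat c d sub by blast
  have mem: "containing_block (blocks X c) (blocks X d) \<in> blocks X d \<rightarrow>\<^sub>E blocks X c"
    using containing_block(1) [OF p le] by (auto simp: containing_block_def)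
  then show "Incl (partition_cat X) c d \<in> Mor (partition_cat X) c d"
    by (auto simp: partition_cat_def)
  obtain x y where "x \<in> X" "y \<in> X" "x \<noteq> y"
    using nonid_partition_two [OF nonid_partition_blocks(1) [OF c]] by blast
  from unstar_star [OF this mem]
  show "unstar X (blocks X c) (blocks X d) (Incl (partition_cat X) c d) =
      containing_block (blocks X c) (blocks X d)"
    by (simp add: partition_cat_def)
qed

text \<open>Each \<open>x\<close> passes to its block in \<open>d\<close>, then to the larger block
  in \<open>c\<close>; by the kernel condition \<open>a\<close> is still constant there, with value
  \<open>a x\<close>. Hence inclusions act trivially on elements.\<close>

lemma waf_inclusion:
  assumes c: "c \<in> Ob (partition_cat X)" and d: "d \<in> Ob (partition_cat X)"
    and sub: "Sub (partition_cat X) c d"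
    and a: "a \<in> X \<rightarrow>\<^sub>E X" "a ` X \<subseteq> A"
    and ker: "Sub (partition_cat X) (bar X (kernel_partition X a)) c"
    and nk: "nonid_partition X (kernel_partition X a)"
  shows "waf X (blocks X d) (containing_block (blocks X c) (blocks X d)) a (\<lambda>x\<in>A. x) = a"
proof
  fix x
  have p: "partition_on X (blocks X c)" "partition_on X (blocks X d)"
    using nonid_partition_blocks c d by (auto simp: nonid_partition_def)
  have le: "\<forall>B\<in>blocks X d. \<exists>C\<in>blocks X c. B \<subseteq> C" using Sub_partition_cat c d sub by blast
  show "waf X (blocks X d) (containing_block (blocks X c) (blocks X d)) a (\<lambda>x\<in>A. x) x = a x"
  proof (cases "x \<in> X")
    case True
    define C where "C = containing_block (blocks X c) (blocks X d) (block_of (blocks X d) x)"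
    have C: "C \<in> blocks X c" "x \<in> C"
      using containing_block [OF p le] block_of [OF p(2) True] by (auto simp: C_def)
    have "\<forall>B\<in>blocks X c. \<exists>K\<in>kernel_partition X a. B \<subseteq> K"
      using Sub_partition_cat_bar [OF nk nonid_partition_blocks(1) [OF c]] ker
        nonid_partition_blocks(2) [OF c] by simp
    then obtain K where "K \<in> kernel_partition X a" "C \<subseteq> K" using C by blast
    then have "\<forall>z\<in>C. a z = a x" using C by (fastforce simp: kernel_partition_def)
    then have "a ` C = (\<lambda>_. a x) ` C" by (intro image_cong) auto
    \<comment> \<open>\<open>C\<close> lies in a single kernel class, so its image is a singleton
      and \<open>the_elem\<close> returns the common value.\<close>
    then have "on_blocks a C = a x" using C(2) by (auto simp: on_blocks_def image_constant_conv)
    then show ?thesis using True a(2) by (auto simp: waf_def C_def [symmetric])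
  next
    case False
    then show ?thesis using a by (auto simp: waf_def)
  qed
qed

section \<open>Singular maps of a finite set\<close>

text \<open>On a finite set a self-map that is not bijective is neither surjective nor injective:
  the first makes its image proper, the second gives its kernel a block with two points.\<close>

lemma Sing_finite:
  assumes "finite X" "X \<noteq> {}" "a \<in> Sing X"
  shows "a ` X \<in> Ob (powerset_cat X)" "nonid_partition X (kernel_partition X a)"
proof -
  have a: "a \<in> X \<rightarrow>\<^sub>E X" "\<not> bij_betw a X X" using assms by (auto simp: Sing_def)
  then have nX: "a ` X \<noteq> X" "\<not> inj_on a X"
    using assms(1) by (auto simp: bij_betw_def eq_card_imp_inj_on dest: endo_inj_surj [rotated 2])
  then show "a ` X \<in> Ob (powerset_cat X)" using a assms(2) by auto
  have "partition_on X (kernel_partition X a)"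
    by (auto simp: partition_on_def kernel_partition_def disjoint_def)
  moreover obtain x y where "x \<in> X" "y \<in> X" "a x = a y" "x \<noteq> y"
    using nX by (auto simp: inj_on_def)
  ultimately show "nonid_partition X (kernel_partition X a)"
    by (auto simp: nonid_partition_def kernel_partition_def intro!: bexI [of _ x] bexI [of _ y])
qed

section \<open>Naturality of the duality along inclusions\<close>

lemma natural_bi_isomorphism_mem:
  assumes "natural_bi_isomorphism X \<Gamma> \<Delta> \<chi>"
    and "A \<in> Ob (powerset_cat X)" "c \<in> Ob (partition_cat X)" "a \<in> \<Gamma>_set X \<Gamma> A c"
  shows "\<chi> A c a \<in> \<Delta>_set X \<Delta> A c"
  using assms unfolding natural_bi_isomorphism_def by (blast dest: bij_betwE)

text \<open>In the naturality square of a pair of inclusions, \<Gamma> and \<Delta> again yield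
  inclusions, so by \<open>waf_inclusion\<close> both bifunctors fix their arguments and the square
  collapses to this equation.\<close>

lemma duality_inclusion:
  assumes fin: "finite X" "X \<noteq> {}"
    and \<Gamma>: "local_isomorphism (partition_cat X) (partition_cat X) \<Gamma>"
    and \<Delta>: "local_isomorphism (powerset_cat X) (powerset_cat X) \<Delta>"
    and nat: "natural_bi_isomorphism X \<Gamma> \<Delta> \<chi>"
    and A: "A \<in> Ob (powerset_cat X)" and B: "B \<in> Ob (powerset_cat X)" and AB: "A \<subseteq> B"
    and c: "c \<in> Ob (partition_cat X)" and d: "d \<in> Ob (partition_cat X)"
    and cd: "Sub (partition_cat X) c d"
    and a: "a \<in> \<Gamma>_set X \<Gamma> A c"
  shows "\<chi> B d a = \<chi> A c a"
proof -
  let ?P = "partition_cat X"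
  have b: "\<chi> A c a \<in> \<Delta>_set X \<Delta> A c"
    by (rule natural_bi_isomorphism_mem [OF nat A c a])
  have "Incl (powerset_cat X) A B \<in> Mor (powerset_cat X) A B" using AB by auto
  then have nat': "\<chi> B d (\<Gamma>_map X \<Gamma> c d (Incl (powerset_cat X) A B) (Incl ?P c d) a) =
      \<Delta>_map X \<Delta> A B c d (Incl (powerset_cat X) A B) (Incl ?P c d) (\<chi> A c a)"
    using nat A B c d a unstar_Incl(2) [OF c d cd] unfolding natural_bi_isomorphism_def by blast
  have "a \<in> Sing X" "\<chi> A c a \<in> Sing X" using a b by (auto simp: \<Gamma>_set_def \<Delta>_set_def)
  then have n: "nonid_partition X (kernel_partition X a)"
      "nonid_partition X (kernel_partition X (\<chi> A c a))"
    using Sing_finite fin by auto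
  have \<Gamma>c: "omap \<Gamma> c \<in> Ob ?P" "omap \<Gamma> d \<in> Ob ?P" using local_isomorphism_Ob [OF \<Gamma>] c d by auto
  note \<Gamma>i = local_isomorphism_Incl [OF \<Gamma> c d cd]
  have "\<Gamma>_map X \<Gamma> c d (Incl (powerset_cat X) A B) (Incl ?P c d) a = a"
    using a n(1) unstar_Incl(1) [OF \<Gamma>c \<Gamma>i(1)]
    by (auto simp: \<Gamma>_map_def \<Gamma>i(2) \<Gamma>_set_def Sing_def intro!: waf_inclusion [OF \<Gamma>c \<Gamma>i(1)])
  moreover have \<Delta>i: "mmap \<Delta> A B (\<lambda>x\<in>A. x) = (\<lambda>x\<in>omap \<Delta> A. x)"
    using local_isomorphism_Incl(2) [OF \<Delta> A B] AB by simp
  have "\<Delta>_map X \<Delta> A B c d (Incl (powerset_cat X) A B) (Incl ?P c d) (\<chi> A c a) = \<chi> A c a"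
    using b n(2) unstar_Incl(1) [OF c d cd]
    by (auto simp: \<Delta>_map_def \<Delta>i \<Delta>_set_def Sing_def intro!: waf_inclusion [OF c d cd])
  ultimately show ?thesis using nat' by simp
qed

section \<open>The first projection as isomorphism\<close>

theorem corollary4p16:
  fixes X :: "'a set"
    and \<Gamma> :: "'a partition_endofunctor"
    and \<Delta> :: "'a powerset_endofunctor"
    and \<chi> :: "'a bitransformation"
  assumes two_elements: "\<exists>x\<in>X. \<exists>y\<in>X. x \<noteq> y"
    and Sing_subsemigroup: "\<forall>a\<in>Sing X. \<forall>b\<in>Sing X. tmul X a b \<in> Sing X"
    and cross_connection: "cross_connection_Pi_P X \<Gamma>"
    and dual: "dual_with_duality X \<Gamma> \<Delta> \<chi>"
  shows "cross_connection_semigroup X \<Gamma> \<Delta> \<chi> \<cong> Sing_semigroup X"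
proof -
  let ?P = "partition_cat X" and ?S = "cross_connection_semigroup X \<Gamma> \<Delta> \<chi>"
  have fin: "finite X" "X \<noteq> {}"
    using finite_if_Sing_closed [OF Sing_subsemigroup] two_elements by blast+
  have \<Gamma>: "local_isomorphism ?P ?P \<Gamma>"
    using cross_connection by (simp add: cross_connection_Pi_P_def)
  have \<Delta>: "local_isomorphism (powerset_cat X) (powerset_cat X) \<Delta>"
    and nat: "natural_bi_isomorphism X \<Gamma> \<Delta> \<chi>"
    using dual by (auto simp: dual_with_duality_def cross_connection_P_Pi_def)
  have inj: "inj_on (omap \<Gamma>) (Ob ?P)"
    using dual by (intro dual_inj_on_objects [OF fin(1) \<Delta>]) (auto simp: dual_with_duality_def)
  have "finite (Ob ?P)"
    unfolding Ob_partition_cat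
    by (intro finite_imageI, rule finite_subset [of _ "Pow (Pow X)"])
      (use fin in \<open>auto simp: nonid_partition_def partition_on_def\<close>)
  then have surj: "omap \<Gamma> ` Ob ?P = Ob ?P"
    using endo_inj_surj inj local_isomorphism_Ob [OF \<Gamma>] by (metis image_subsetI)

  \<comment> \<open>The smallest pair is formed by the image of \<open>a\<close> and the object that
    \<Gamma> sends to the kernel partition of \<open>a\<close>.\<close>
  have smallest: "\<exists>c\<in>Ob ?P. a \<in> \<Gamma>_set X \<Gamma> (a ` X) c \<and>
      (\<forall>B\<in>Ob (powerset_cat X). \<forall>d\<in>Ob ?P. a \<in> \<Gamma>_set X \<Gamma> B d \<longrightarrow> \<chi> B d a = \<chi> (a ` X) c a)"
    if a: "a \<in> Sing X" for a
  proof -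
    note Sa = Sing_finite [OF fin a]
    define k where "k = bar X (kernel_partition X a)"
    have k: "k \<in> Ob ?P" using Sa by (auto simp: k_def Ob_partition_cat)
    then obtain c where c: "c \<in> Ob ?P" "omap \<Gamma> c = k" by (metis surj imageE)
    have "Sub ?P k k" using Sub_partition_cat [OF k k] by blast
    then have ac: "a \<in> \<Gamma>_set X \<Gamma> (a ` X) c" using a c by (auto simp: \<Gamma>_set_def k_def)
    have "\<chi> B d a = \<chi> (a ` X) c a"
      if B: "B \<in> Ob (powerset_cat X)" and d: "d \<in> Ob ?P" and aBd: "a \<in> \<Gamma>_set X \<Gamma> B d" for B d
    proof -
      \<comment> \<open>The order must be reflected by \<Gamma>: the ideal at \<open>d\<close>
        supplies a preimage \<open>e\<close> of \<open>k\<close> below \<open>d\<close>, and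
        injectivity on objects identifies \<open>e\<close> with \<open>c\<close>.\<close>
      have "k \<in> {e \<in> Ob ?P. Sub ?P e (omap \<Gamma> d)}" "a ` X \<subseteq> B"
        using aBd k by (auto simp: \<Gamma>_set_def k_def)
      then obtain e where "e \<in> Ob ?P" "Sub ?P e d" "omap \<Gamma> e = k"
        using bij_betw_imp_surj_on [OF local_isomorphism_ideal [OF \<Gamma> d]]
        by (smt (verit, best) imageE mem_Collect_eq)
      then have "Sub ?P c d" using inj c by (metis inj_onD)
      then show ?thesis
        using duality_inclusion [OF fin \<Gamma> \<Delta> nat Sa(1) B _ c(1) d _ ac] \<open>a ` X \<subseteq> B\<close> by blast
    qed
    then show ?thesis using c ac by blast
  qed

  have "fst \<in> hom ?S (Sing_semigroup X)"
    using Sing_subsemigroup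
    by (fastforce simp: hom_def cross_connection_semigroup_def Sing_semigroup_def U\<Gamma>_def \<Gamma>_set_def)
  moreover have "inj_on fst (carrier ?S)"
  proof (rule inj_onI)
    fix p q assume "p \<in> carrier ?S" "q \<in> carrier ?S" and eq: "fst p = fst q"
    then have l: "linked X \<Gamma> \<chi> (fst p) (snd p)" "linked X \<Gamma> \<chi> (fst p) (snd q)"
      by (auto simp: cross_connection_semigroup_def)
    then have "fst p \<in> Sing X" by (auto simp: linked_def \<Gamma>_set_def)
    \<comment> \<open>Both second components are values of \<chi> at \<open>fst p\<close>, hence
      equal the value at its smallest pair.\<close>
    then have "snd p = snd q" using smallest [of "fst p"] l unfolding linked_def by metis
    then show "p = q" using eq by (simp add: prod_eq_iff)
  qed
  moreover have "fst ` carrier ?S = Sing X"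
  proof
    show "fst ` carrier ?S \<subseteq> Sing X"
      by (auto simp: cross_connection_semigroup_def U\<Gamma>_def \<Gamma>_set_def)
    show "Sing X \<subseteq> fst ` carrier ?S"
    proof
      fix a assume a: "a \<in> Sing X"
      then obtain c where c: "c \<in> Ob ?P" "a \<in> \<Gamma>_set X \<Gamma> (a ` X) c" using smallest by blast
      note im = Sing_finite(1) [OF fin a]
      have "\<chi> (a ` X) c a \<in> \<Delta>_set X \<Delta> (a ` X) c"
        by (rule natural_bi_isomorphism_mem [OF nat im c])
      \<comment> \<open>The smallest pair of \<open>a\<close> witnesses the link and both
        memberships.\<close>
      then have "(a, \<chi> (a ` X) c a) \<in> carrier ?S"
        using im c unfolding cross_connection_semigroup_def U\<Gamma>_def U\<Delta>_def linked_def
        by (simp del: powerset_cat_simps) blast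
      then show "a \<in> fst ` carrier ?S" by force
    qed
  qed
  ultimately have "fst \<in> iso ?S (Sing_semigroup X)"
    by (auto simp: iso_def bij_betw_def Sing_semigroup_def)
  then show ?thesis by (auto simp: is_iso_def)
qed

end
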